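(* There exist a Fuchsian group $G \leq \mathrm{Isom}(\mathbb{H}^2)$ and subgroups $G_1, G_2 \leq G$ such that $\Lambda_{\mathrm{r}}(G_1) \cap \Lambda_{\mathrm{r}}(G_2) \neq \emptyset$ but $G_1 \cap G_2 = \{e\}$, where $e$ is the identity element. In particular, the following assertion is false: for every integer $d \geq 2$, every non-elementary discrete group $G \leq \mathrm{Isom}(\mathbb{H}^d)$, and every pair of non-elementary subgroups $G_1, G_2 \leq G$, one has $$\Lambda_{\mathrm{r}}(G_1) \cap \Lambda_{\mathrm{r}}(G_2) \subseteq \Lambda(G_1 \cap G_2).$$
   Context: For an integer $d \geq 2$, $\mathbb{H}^d$ denotes $d$-dimensional real hyperbolic space, $\partial \mathbb{H}^d$ its boundary at infinity, $\mathrm{Isom}(\mathbb{H}^d)$ its isometry group, and $o \in \mathbb{H}^d$ a fixed base point (the definitions below do not depend on the choice of $o$). A group $G \leq \mathrm{Isom}(\mathbb{H}^d)$ is discrete if for every $R > 0$ the set $\{g \in G : \mathrm{dist}_{\mathbb{H}}(o, g(o)) \leq R\}$ is finite. A Fuchsian group is a discrete subgroup of $\mathrm{Isom}(\mathbb{H}^2)$. The limit set of $G$ is $$\Lambda(G) = \{\xi \in \partial\mathbb{H}^d : \text{there is a sequence } (g_n)_{n\ge 1} \text{ in } G \text{ with } g_n(o) \to \xi\}.$$ The group $G$ is non-elementary if $\Lambda(G)$ contains at least three points. For $\eta \in \partial\mathbb{H}^d$, $[o,\eta]_{\mathbb{H}}$ denotes the hyperbolic geodesic ray from $o$ to $\eta$,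 and $B(x,r)$ denotes the hyperbolic ball of radius $r$ centered at $x$. The radial limit set $\Lambda_{\mathrm{r}}(G)$ is the set of all $\eta \in \Lambda(G)$ for which there exist $c > 0$ and a sequence $(g_n)_{n \ge 1}$ in $G$ such that $g_n(o) \to \eta$ and $[o,\eta]_{\mathbb{H}} \cap B(g_n(o), c) \neq \emptyset$ for all $n$. *)

theory Defs
  imports "HOL-Analysis.Analysis" "HOL-Algebra.Bij"
begin

text \<open>
  The dimension \<open>d\<close> is a term-level parameter. We use the Poincare ball model inside
  \<^term>\<open>Euclidean_space d\<close>, whose points are the functions \<open>x :: nat \<Rightarrow> real\<close> with
  \<open>x i = 0\<close> for all \<open>i \<ge> d\<close>.
\<close>

definition sqnorm :: "nat \<Rightarrow> (nat \<Rightarrow> real) \<Rightarrow> real" where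
  "sqnorm d x = (\<Sum>i<d. (x i)\<^sup>2)"

definition hyp_space :: "nat \<Rightarrow> (nat \<Rightarrow> real) set" where
  "hyp_space d = {x \<in> topspace (Euclidean_space d). sqnorm d x < 1}"

definition hyp_boundary :: "nat \<Rightarrow> (nat \<Rightarrow> real) set" where
  "hyp_boundary d = {x \<in> topspace (Euclidean_space d). sqnorm d x = 1}"

definition hyp_dist :: "nat \<Rightarrow> (nat \<Rightarrow> real) \<Rightarrow> (nat \<Rightarrow> real) \<Rightarrow> real" where
  "hyp_dist d x y =
     arcosh (1 + 2 * sqnorm d (\<lambda>i. x i - y i) / ((1 - sqnorm d x) * (1 - sqnorm d y)))"

definition hyp_ball :: "nat \<Rightarrow> (nat \<Rightarrow> real) \<Rightarrow> real \<Rightarrow> (nat \<Rightarrow> real) set" where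
  "hyp_ball d x r = {y \<in> hyp_space d. hyp_dist d x y < r}"

definition base_point :: "nat \<Rightarrow> real" where
  "base_point = (\<lambda>_. 0)"

text \<open>
  Isometries are extensional functions (\<^term>\<open>undefined\<close> off \<^term>\<open>hyp_space d\<close>), so
  equality of group elements is equality as self-maps of hyperbolic space.
\<close>

definition Isom :: "nat \<Rightarrow> ((nat \<Rightarrow> real) \<Rightarrow> (nat \<Rightarrow> real)) monoid" where
  "Isom d = (BijGroup (hyp_space d))
     \<lparr>carrier := {f \<in> Bij (hyp_space d).
        \<forall>x\<in>hyp_space d. \<forall>y\<in>hyp_space d. hyp_dist d (f x) (f y) = hyp_dist d x y}\<rparr>"

lemma group_Isom: "group (Isom d)"
proof -
  let ?H = "hyp_space d"
  let ?I = "{f \<in> Bij ?H. \<forall>x\<in>?H. \<forall>y\<in>?H. hyp_dist d (f x) (f y) = hyp_dist d x y}"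
  interpret B: group "BijGroup ?H" by (rule group_BijGroup)
  have "subgroup ?I (BijGroup ?H)"
  proof (rule B.subgroupI)
    show "?I \<subseteq> carrier (BijGroup ?H)" by (auto simp: BijGroup_def)
    show "?I \<noteq> {}" using id_Bij[of ?H] by (auto intro!: exI[of _ "\<lambda>x\<in>?H. x"])
  next
    fix f assume f: "f \<in> ?I"
    have bij: "bij_betw f ?H ?H" using f by (simp add: Bij_def)
    have "hyp_dist d (inv_into ?H f x) (inv_into ?H f y) = hyp_dist d x y"
      if "x \<in> ?H" "y \<in> ?H" for x y
    proof -
      have "inv_into ?H f x \<in> ?H" "inv_into ?H f y \<in> ?H"
        using bij that by (auto simp: bij_betw_def intro: inv_into_into)
      then have "hyp_dist d (f (inv_into ?H f x)) (f (inv_into ?H f y))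
          = hyp_dist d (inv_into ?H f x) (inv_into ?H f y)"
        using f by blast
      then show ?thesis using bij that by (simp add: bij_betw_inv_into_right)
    qed
    then show "inv\<^bsub>BijGroup ?H\<^esub> f \<in> ?I"
      using f by (simp add: inv_BijGroup restrict_inv_into_Bij)
  next
    fix f g assume fg: "f \<in> ?I" "g \<in> ?I"
    have "g x \<in> ?H" if "x \<in> ?H" for x
      using fg(2) that by (auto dest: Bij_imp_funcset)
    then show "f \<otimes>\<^bsub>BijGroup ?H\<^esub> g \<in> ?I"
      using fg by (simp add: BijGroup_def compose_Bij compose_eq)
  qed
  then show ?thesis
    unfolding Isom_def by (rule B.subgroup_imp_group)
qed

definition discrete_isom :: "nat \<Rightarrow> ((nat \<Rightarrow> real) \<Rightarrow> (nat \<Rightarrow> real)) set \<Rightarrow> bool" where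
  "discrete_isom d G \<longleftrightarrow>
     (\<forall>R>0. finite {g \<in> G. hyp_dist d base_point (g base_point) \<le> R})"

definition Fuchsian :: "((nat \<Rightarrow> real) \<Rightarrow> (nat \<Rightarrow> real)) set \<Rightarrow> bool" where
  "Fuchsian G \<longleftrightarrow> subgroup G (Isom 2) \<and> discrete_isom 2 G"

definition limit_set :: "nat \<Rightarrow> ((nat \<Rightarrow> real) \<Rightarrow> (nat \<Rightarrow> real)) set \<Rightarrow> (nat \<Rightarrow> real) set" where
  "limit_set d G = {\<xi> \<in> hyp_boundary d.
     \<exists>g :: nat \<Rightarrow> _. (\<forall>n. g n \<in> G) \<and>
       limitin (Euclidean_space d) (\<lambda>n. g n base_point) \<xi> sequentially}"

definition non_elementary :: "nat \<Rightarrow> ((nat \<Rightarrow> real) \<Rightarrow> (nat \<Rightarrow> real)) set \<Rightarrow> bool" where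
  "non_elementary d G \<longleftrightarrow> (\<exists>T \<subseteq> limit_set d G. card T = 3)"

definition is_geodesic_ray ::
  "nat \<Rightarrow> (nat \<Rightarrow> real) \<Rightarrow> (nat \<Rightarrow> real) \<Rightarrow> (real \<Rightarrow> nat \<Rightarrow> real) \<Rightarrow> bool" where
  "is_geodesic_ray d x \<eta> \<gamma> \<longleftrightarrow>
     \<gamma> 0 = x \<and> (\<forall>t\<ge>0. \<gamma> t \<in> hyp_space d) \<and>
     (\<forall>s\<ge>0. \<forall>t\<ge>0. hyp_dist d (\<gamma> s) (\<gamma> t) = \<bar>s - t\<bar>) \<and>
     limitin (Euclidean_space d) \<gamma> \<eta> at_top"

text \<open>
  For \<open>x\<close> in hyperbolic space and \<open>\<eta>\<close> on its boundary there is exactly one geodesic ray from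
  \<open>x\<close> to \<open>\<eta>\<close> (up to its values at negative parameters), so the union is over one set.
\<close>

definition geodesic_ray :: "nat \<Rightarrow> (nat \<Rightarrow> real) \<Rightarrow> (nat \<Rightarrow> real) \<Rightarrow> (nat \<Rightarrow> real) set" where
  "geodesic_ray d x \<eta> = \<Union> {\<gamma> ` {0..} | \<gamma>. is_geodesic_ray d x \<eta> \<gamma>}"

definition radial_limit_set ::
  "nat \<Rightarrow> ((nat \<Rightarrow> real) \<Rightarrow> (nat \<Rightarrow> real)) set \<Rightarrow> (nat \<Rightarrow> real) set" where
  "radial_limit_set d G = {\<eta> \<in> limit_set d G.
     \<exists>c>0. \<exists>g :: nat \<Rightarrow> _. (\<forall>n. g n \<in> G) \<and>
       limitin (Euclidean_space d) (\<lambda>n. g n base_point) \<eta> sequentially \<and>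
       (\<forall>n. geodesic_ray d base_point \<eta> \<inter> hyp_ball d (g n base_point) c \<noteq> {})}"

end

theory Submission
  imports Defs
begin

text \<open>
  The counterexample lives in a free product of infinitely many groups of order two. Let
  \<open>\<rho>\<^sub>0, \<rho>\<^sub>1, \<rho>\<^sub>2, \<dots>\<close> be reflections in geodesics of the hyperbolic plane that cut off pairwise
  disjoint half planes (caps) not containing the base point. By the ping-pong argument an
  element of the group \<open>G\<close> that they generate is the same thing as a word without equal
  neighbouring letters, and the first letter can be read off from the cap that the element
  moves the base point into (\<open>ping_pong\<close>, \<open>free_orbit\<close>). As all caps keep a fixed distance from
  the base point, the orbit is uniformly separated and \<open>G\<close> is discrete
  (\<open>discrete_word_group\<close>).

  Consider the infinite word \<open>\<rho>\<^sub>0\<rho>\<^sub>1\<rho>\<^sub>2\<rho>\<^sub>3\<dots>\<close>. Its prefixes of even length lie in the subgroup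
  \<open>G\<^sub>1\<close> generated by \<open>\<rho>\<^sub>0\<rho>\<^sub>1, \<rho>\<^sub>2\<rho>\<^sub>3, \<dots>\<close>, and its prefixes of odd length lie in the subgroup
  \<open>G\<^sub>2\<close> generated by \<open>\<rho>\<^sub>0, \<rho>\<^sub>1\<rho>\<^sub>2, \<rho>\<^sub>3\<rho>\<^sub>4, \<dots>\<close>. If the prefixes move the base point radially to a
  boundary point \<open>\<eta>\<close>, then \<open>\<eta>\<close> is a radial limit point of both subgroups. Nevertheless
  \<open>G\<^sub>1 \<inter> G\<^sub>2\<close> is trivial: reduction only ever cancels whole blocks, so the reduced word of a
  common element splits into blocks of both kinds; the block \<open>\<rho>\<^sub>0\<rho>\<^sub>1\<close> of the first splitting
  overlaps the block \<open>\<rho>\<^sub>1\<rho>\<^sub>2\<close> of the second, which overlaps \<open>\<rho>\<^sub>2\<rho>\<^sub>3\<close>, and so on, so that a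
  nonempty word would never end (\<open>no_staircase\<close>, \<open>word_group_inter\<close>).

  For radial convergence, look from the prefix \<open>g = \<rho>\<^sub>0\<dots>\<rho>\<^sub>n\<close>: the base point is seen in the cap
  of \<open>\<rho>\<^sub>n\<close>, all later prefixes in the cap of \<open>\<rho>\<^sub>n\<^sub>+\<^sub>1\<close>. If consecutive caps stay a fixed
  Euclidean distance apart, the geodesic between the two passes near the centre, and the images
  of later prefixes stay in a Stolz angle at \<open>\<eta>\<close> (\<open>disc_isometry_shadow\<close>, \<open>prefix_shadow\<close>).
  This is arranged by placing the caps with even index near \<open>1\<close> and those with odd index
  near \<open>-1\<close>.

  Finally, each of the three groups has infinitely many elements whose reduced word starts with
  a given letter, hence a limit point in every closed cap, so all three are non-elementary.
\<close>

section \<open>The hyperbolic plane as the complex unit disc\<close>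

definition to_plane :: "complex \<Rightarrow> nat \<Rightarrow> real" where
  "to_plane z = (\<lambda>i. if i = 0 then Re z else if i = 1 then Im z else 0)"

definition of_plane :: "(nat \<Rightarrow> real) \<Rightarrow> complex" where
  "of_plane x = Complex (x 0) (x 1)"

text \<open>This is \<open>sinh\<^sup>2 (d/2)\<close> for the hyperbolic distance \<open>d\<close>.\<close>

definition invariant_ratio :: "complex \<Rightarrow> complex \<Rightarrow> real" where
  "invariant_ratio z w = (cmod (z - w))\<^sup>2 / ((1 - (cmod z)\<^sup>2) * (1 - (cmod w)\<^sup>2))"

text \<open>
  The group \<^term>\<open>Isom 2\<close> consists of extensional functions, so a map of the disc is cut off
  outside the disc.
\<close>

definition disc_map :: "(complex \<Rightarrow> complex) \<Rightarrow> (nat \<Rightarrow> real) \<Rightarrow> nat \<Rightarrow> real" where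
  "disc_map f = (\<lambda>x\<in>hyp_space 2. to_plane (f (of_plane x)))"

lemma of_plane_to_plane [simp]: "of_plane (to_plane z) = z"
  by (simp add: of_plane_def to_plane_def complex_eq_iff)

lemma to_plane_inject [simp]: "to_plane z = to_plane w \<longleftrightarrow> z = w"
  by (metis of_plane_to_plane)

lemma to_plane_of_plane: "x \<in> topspace (Euclidean_space 2) \<Longrightarrow> to_plane (of_plane x) = x"
  by (auto simp: of_plane_def to_plane_def topspace_Euclidean_space fun_eq_iff)

lemma to_plane_in_space: "to_plane z \<in> topspace (Euclidean_space 2)"
  by (auto simp: to_plane_def topspace_Euclidean_space)

lemma sqnorm_to_plane: "sqnorm 2 (to_plane z) = (cmod z)\<^sup>2"
  by (simp add: sqnorm_def to_plane_def cmod_power2 lessThan_nat_numeral lessThan_Suc)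

lemma sqnorm_diff_to_plane:
  "sqnorm 2 (\<lambda>i. to_plane z i - to_plane w i) = (cmod (z - w))\<^sup>2"
  by (simp add: sqnorm_def to_plane_def cmod_power2 lessThan_nat_numeral lessThan_Suc)

lemma to_plane_mem_hyp_space [simp]: "to_plane z \<in> hyp_space 2 \<longleftrightarrow> cmod z < 1"
  by (simp add: hyp_space_def to_plane_in_space sqnorm_to_plane abs_square_less_1)

lemma to_plane_mem_hyp_boundary [simp]: "to_plane z \<in> hyp_boundary 2 \<longleftrightarrow> cmod z = 1"
  by (simp add: hyp_boundary_def to_plane_in_space sqnorm_to_plane abs_square_eq_1)

lemma hyp_space_cases:
  assumes "x \<in> hyp_space 2"
  obtains z where "x = to_plane z" "cmod z < 1"
proof
  have "x \<in> topspace (Euclidean_space 2)" using assms by (simp add: hyp_space_def)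
  then show eq: "x = to_plane (of_plane x)" by (rule to_plane_of_plane[symmetric])
  show "cmod (of_plane x) < 1" using assms by (subst (asm) eq) simp
qed

lemma base_point_eq: "base_point = to_plane 0"
  by (auto simp: base_point_def to_plane_def)

lemma hyp_dist_to_plane:
  "hyp_dist 2 (to_plane z) (to_plane w) = arcosh (1 + 2 * invariant_ratio z w)"
  by (simp add: hyp_dist_def sqnorm_to_plane sqnorm_diff_to_plane invariant_ratio_def)

lemma limitin_to_plane:
  "limitin (Euclidean_space 2) (\<lambda>n. to_plane (f n)) (to_plane l) F \<longleftrightarrow> (f \<longlongrightarrow> l) F"
proof -
  have "limitin (Euclidean_space 2) (\<lambda>n. to_plane (f n)) (to_plane l) F \<longleftrightarrow>
    (\<forall>i. ((\<lambda>n. to_plane (f n) i) \<longlongrightarrow> to_plane l i) F)"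
    using to_plane_in_space
    by (auto simp: Euclidean_space_def limitin_subtopology limitin_componentwise)
  also have "\<dots> \<longleftrightarrow> ((\<lambda>n. Re (f n)) \<longlongrightarrow> Re l) F \<and> ((\<lambda>n. Im (f n)) \<longlongrightarrow> Im l) F"
  proof
    assume *: "\<forall>i. ((\<lambda>n. to_plane (f n) i) \<longlongrightarrow> to_plane l i) F"
    show "((\<lambda>n. Re (f n)) \<longlongrightarrow> Re l) F \<and> ((\<lambda>n. Im (f n)) \<longlongrightarrow> Im l) F"
      using *[rule_format, of 0] *[rule_format, of 1] by (simp add: to_plane_def)
  qed (auto simp: to_plane_def)
  finally show ?thesis by (simp add: tendsto_complex_iff)
qed

lemma disc_map_to_plane: "cmod z < 1 \<Longrightarrow> disc_map f (to_plane z) = to_plane (f z)"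
  by (simp add: disc_map_def)

definition disc_isometry :: "(complex \<Rightarrow> complex) \<Rightarrow> bool" where
  "disc_isometry f \<longleftrightarrow> (\<forall>z. cmod z < 1 \<longrightarrow> cmod (f z) < 1) \<and>
     (\<forall>z w. cmod z < 1 \<longrightarrow> cmod w < 1 \<longrightarrow> invariant_ratio (f z) (f w) = invariant_ratio z w)"

lemma disc_map_in_Isom:
  assumes f: "disc_isometry f" and g: "disc_isometry g"
    and fg: "\<And>z. cmod z < 1 \<Longrightarrow> f (g z) = z" and gf: "\<And>z. cmod z < 1 \<Longrightarrow> g (f z) = z"
  shows "disc_map f \<in> carrier (Isom 2)"
proof -
  have "bij_betw (disc_map f) (hyp_space 2) (hyp_space 2)"
    using f g fg gf
    by (intro bij_betw_byWitness[where f' = "disc_map g"])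
      (auto elim!: hyp_space_cases simp: disc_map_to_plane disc_isometry_def)
  then have "disc_map f \<in> Bij (hyp_space 2)"
    by (simp add: Bij_def disc_map_def)
  moreover have "hyp_dist 2 (disc_map f x) (disc_map f y) = hyp_dist 2 x y"
    if "x \<in> hyp_space 2" "y \<in> hyp_space 2" for x y
    using that f
    by (auto elim!: hyp_space_cases simp: disc_map_to_plane disc_isometry_def hyp_dist_to_plane)
  ultimately show ?thesis by (simp add: Isom_def)
qed

lemma disc_map_mult:
  assumes "disc_map f \<in> carrier (Isom 2)" "disc_map g \<in> carrier (Isom 2)" "disc_isometry g"
  shows "disc_map f \<otimes>\<^bsub>Isom 2\<^esub> disc_map g = disc_map (f \<circ> g)"
proof -
  have "disc_map f \<otimes>\<^bsub>Isom 2\<^esub> disc_map g = compose (hyp_space 2) (disc_map f) (disc_map g)"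
    using assms(1,2) by (simp add: Isom_def BijGroup_def)
  also have "\<dots> = disc_map (f \<circ> g)"
  proof
    fix x show "compose (hyp_space 2) (disc_map f) (disc_map g) x = disc_map (f \<circ> g) x"
    proof (cases "x \<in> hyp_space 2")
      case True
      then obtain z where "x = to_plane z" "cmod z < 1" by (rule hyp_space_cases)
      then show ?thesis using assms(3) by (simp add: compose_def disc_map_to_plane disc_isometry_def)
    qed (simp add: compose_def disc_map_def)
  qed
  finally show ?thesis .
qed

lemma disc_map_cong:
  assumes "\<And>z. cmod z < 1 \<Longrightarrow> f z = g z"
  shows "disc_map f = disc_map g"
  unfolding disc_map_def using assms by (auto elim!: hyp_space_cases intro!: restrict_ext)

lemma one_Isom_eq: "\<one>\<^bsub>Isom 2\<^esub> = disc_map id"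
proof -
  have "\<one>\<^bsub>Isom 2\<^esub> = (\<lambda>x\<in>hyp_space 2. x)" by (simp add: Isom_def BijGroup_def)
  then show ?thesis
    unfolding disc_map_def by (auto elim!: hyp_space_cases intro!: restrict_ext)
qed

section \<open>Radii and Stolz angles\<close>

lemma invariant_ratio_0: "invariant_ratio 0 z = (cmod z)\<^sup>2 / (1 - (cmod z)\<^sup>2)"
  by (simp add: invariant_ratio_def)

lemma invariant_ratio_nonneg: "cmod z < 1 \<Longrightarrow> cmod w < 1 \<Longrightarrow> 0 \<le> invariant_ratio z w"
  by (simp add: invariant_ratio_def abs_square_le_1)

text \<open>
  Writing \<open>a = s/2\<close> and \<open>b = t/2\<close>, the addition theorem turns the difference
  \<open>tanh a - tanh b\<close> into \<open>sinh (a - b) / (cosh a * cosh b)\<close>, and the denominators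
  cancel against the factors \<open>1 - tanh\<^sup>2\<close> of the metric.
\<close>

lemma hyp_dist_diameter:
  assumes "cmod \<eta> = 1"
  shows "hyp_dist 2 (to_plane (of_real (tanh (s/2)) * \<eta>)) (to_plane (of_real (tanh (t/2)) * \<eta>)) = \<bar>s - t\<bar>"
proof -
  define a b where "a = s/2" and "b = t/2"
  have c: "cosh a \<noteq> 0" "cosh b \<noteq> 0" by simp_all
  have d: "1 - (tanh u)\<^sup>2 = 1 / (cosh u)\<^sup>2" for u :: real
  proof -
    have "1 - (tanh u)\<^sup>2 = ((cosh u)\<^sup>2 - (sinh u)\<^sup>2) / (cosh u)\<^sup>2"
      by (simp add: tanh_def power_divide diff_divide_distrib)
    then show ?thesis using cosh_square_eq[of u] by simp
  qed
  have n: "cmod (of_real (tanh a) * \<eta> - of_real (tanh b) * \<eta>) = \<bar>tanh a - tanh b\<bar>"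
    using assms by (metis left_diff_distrib norm_mult mult.right_neutral norm_of_real of_real_diff)
  have e: "tanh a - tanh b = sinh (a - b) / (cosh a * cosh b)"
    using c by (simp add: tanh_def sinh_diff field_simps)
  have "invariant_ratio (of_real (tanh a) * \<eta>) (of_real (tanh b) * \<eta>) = (sinh (a - b))\<^sup>2"
    using c unfolding invariant_ratio_def n
    by (simp add: norm_mult assms d e power_divide power_mult_distrib)
  moreover have "1 + 2 * (sinh (a - b))\<^sup>2 = cosh \<bar>s - t\<bar>"
  proof -
    have "2 * (a - b) = s - t" by (simp add: a_def b_def field_simps)
    then show ?thesis
      using cosh_double[of "a - b"] cosh_square_eq[of "a - b"] by simp
  qed
  ultimately show ?thesis
    by (simp add: hyp_dist_to_plane a_def[symmetric] b_def[symmetric] arcosh_cosh_real del: cosh_real_abs)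
qed

lemma is_geodesic_ray_radius:
  assumes "cmod \<eta> = 1"
  shows "is_geodesic_ray 2 base_point (to_plane \<eta>) (\<lambda>t. to_plane (of_real (tanh (t/2)) * \<eta>))"
proof -
  have "filterlim (\<lambda>t::real. t/2) at_top at_top"
    using filterlim_at_top_mult_tendsto_pos[OF tendsto_const[of "1/2::real"] _ filterlim_ident] by simp
  then have "((\<lambda>t::real. tanh (t/2)) \<longlongrightarrow> 1) at_top"
    by (rule filterlim_compose[OF tanh_real_at_top])
  then have "((\<lambda>t. of_real (tanh (t/2)) * \<eta>) \<longlongrightarrow> of_real 1 * \<eta>) at_top"
    by (intro tendsto_intros)
  moreover have "\<bar>tanh u\<bar> < 1" for u :: real
    using tanh_real_bounds[of u] by auto
  ultimately show ?thesis
    using assms hyp_dist_diameter[OF assms]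
    by (simp add: is_geodesic_ray_def base_point_eq limitin_to_plane norm_mult tanh_real_lt_1)
qed

lemma radius_subset_geodesic_ray:
  assumes "cmod \<eta> = 1" "0 \<le> r" "r < 1"
  shows "to_plane (of_real r * \<eta>) \<in> geodesic_ray 2 base_point (to_plane \<eta>)"
proof -
  define y where "y = (1 + r) / (1 - r)"
  have "y \<ge> 1" using assms(2,3) by (simp add: y_def)
  define u where "u = ln (sqrt y)"
  have "u \<ge> 0" using \<open>y \<ge> 1\<close> by (simp add: u_def)
  have "tanh u = (y - 1) / (y + 1)"
    using \<open>y \<ge> 1\<close> by (simp add: u_def tanh_ln_real)
  moreover have "y - 1 = 2 * r / (1 - r)" "y + 1 = 2 / (1 - r)"
    using assms(3) by (simp_all add: y_def field_simps)
  ultimately have "r = tanh u" using assms(3) by simp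
  then show ?thesis
    using is_geodesic_ray_radius[OF assms(1)] \<open>u \<ge> 0\<close> unfolding geodesic_ray_def
    by (intro UnionI[of "(\<lambda>t. to_plane (of_real (tanh (t/2)) * \<eta>)) ` {0..}"] CollectI
        exI[of _ "\<lambda>t. to_plane (of_real (tanh (t/2)) * \<eta>)"] conjI refl image_eqI[of _ _ "2 * u"]) auto
qed

text \<open>
  In a Stolz angle at \<open>\<eta>\<close> the point of the radius to \<open>\<eta>\<close> that has the same modulus as \<open>w\<close> is
  within bounded hyperbolic distance of \<open>w\<close>, because its Euclidean distance from \<open>w\<close> is at most
  \<open>C + 1\<close> times the distance of \<open>w\<close> from the unit circle.
\<close>

lemma stolz_angle_meets_ball:
  assumes \<eta>: "cmod \<eta> = 1" and w: "cmod w < 1" and C: "cmod (\<eta> - w) \<le> C * (1 - cmod w)"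
  shows "geodesic_ray 2 base_point (to_plane \<eta>) \<inter> hyp_ball 2 (to_plane w) (arcosh (2 + 2 * (C + 1)\<^sup>2)) \<noteq> {}"
proof -
  define u where "u = of_real (cmod w) * \<eta>"
  have nu: "cmod u = cmod w" using \<eta> by (simp add: u_def norm_mult)
  have "u - \<eta> = of_real (cmod w - 1) * \<eta>" by (simp add: u_def algebra_simps)
  then have "cmod (u - \<eta>) = 1 - cmod w"
    using \<eta> w by (metis abs_minus_commute abs_of_pos diff_gt_0_iff_gt mult.right_neutral norm_mult norm_of_real)
  then have "cmod (w - u) \<le> (C + 1) * (1 - cmod w)"
    using C norm_triangle_ineq[of "w - \<eta>" "\<eta> - u"]
    by (simp add: norm_minus_commute algebra_simps)
  then have "(cmod (w - u))\<^sup>2 \<le> ((C + 1) * (1 - cmod w))\<^sup>2" by (intro power_mono) auto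
  also have "\<dots> \<le> (C + 1)\<^sup>2 * (1 - (cmod w)\<^sup>2)\<^sup>2"
  proof -
    have "(cmod w)\<^sup>2 \<le> cmod w" using w by (simp add: power2_eq_square mult_left_le)
    then have "(1 - cmod w)\<^sup>2 \<le> (1 - (cmod w)\<^sup>2)\<^sup>2" using w by (intro power_mono) auto
    then show ?thesis by (simp add: power_mult_distrib mult_left_mono)
  qed
  finally have "invariant_ratio w u \<le> (C + 1)\<^sup>2"
    using w by (simp add: invariant_ratio_def nu power2_eq_square[of "1 - _"] divide_le_eq abs_square_less_1
        zero_less_mult_iff)
  moreover have "0 \<le> invariant_ratio w u" using w nu by (simp add: invariant_ratio_nonneg)
  ultimately have "hyp_dist 2 (to_plane w) (to_plane u) < arcosh (2 + 2 * (C + 1)\<^sup>2)"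
    unfolding hyp_dist_to_plane by (intro arcosh_real_strict_mono) auto
  then have "to_plane u \<in> hyp_ball 2 (to_plane w) (arcosh (2 + 2 * (C + 1)\<^sup>2))"
    using w nu by (simp add: hyp_ball_def)
  moreover have "to_plane u \<in> geodesic_ray 2 base_point (to_plane \<eta>)"
    unfolding u_def using \<eta> w by (intro radius_subset_geodesic_ray) auto
  ultimately show ?thesis by blast
qed

lemma radial_limit_setI:
  fixes g :: "nat \<Rightarrow> complex \<Rightarrow> complex"
  assumes \<eta>: "cmod \<eta> = 1" and g: "\<And>n. disc_map (g n) \<in> G" and disc: "\<And>n. cmod (g n 0) < 1"
    and lim: "(\<lambda>n. g n 0) \<longlonglongrightarrow> \<eta>" and stolz: "\<And>n. cmod (\<eta> - g n 0) \<le> C * (1 - cmod (g n 0))"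
  shows "to_plane \<eta> \<in> radial_limit_set 2 G"
proof -
  have lim': "limitin (Euclidean_space 2) (\<lambda>n. disc_map (g n) base_point) (to_plane \<eta>) sequentially"
    using lim by (simp add: base_point_eq disc_map_to_plane limitin_to_plane)
  then have "to_plane \<eta> \<in> limit_set 2 G"
    using g \<eta> unfolding limit_set_def
    by (intro CollectI conjI exI[of _ "\<lambda>n. disc_map (g n)"]) auto
  moreover have "geodesic_ray 2 base_point (to_plane \<eta>) \<inter>
      hyp_ball 2 (disc_map (g n) base_point) (arcosh (2 + 2 * (C + 1)\<^sup>2)) \<noteq> {}" for n
    using stolz_angle_meets_ball[OF \<eta> disc stolz] by (simp add: base_point_eq disc_map_to_plane)
  moreover have "arcosh (2 + 2 * (C + 1)\<^sup>2) > 0"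
    using zero_le_power2[of "C + 1"] by (subst arcosh_real_gt_1_iff) linarith+
  ultimately show ?thesis
    using g lim' unfolding radial_limit_set_def
    by (intro CollectI conjI exI[of _ "arcosh (2 + 2 * (C + 1)\<^sup>2)"] exI[of _ "\<lambda>n. disc_map (g n)"] allI) simp_all
qed

text \<open>
  If \<open>u = f\<^sup>-\<^sup>1 0\<close> and \<open>v\<close> are far apart in the Euclidean sense, then \<open>f 0\<close> lies near the geodesic
  from \<open>0\<close> to \<open>f v\<close>. The estimate says that the part of the disc separated from \<open>u\<close> is mapped into
  a Euclidean ball around \<open>f 0\<close> whose radius is comparable with the distance of \<open>f 0\<close> from the
  unit circle. It uses three cases of invariance: the pair \<open>u, 0\<close> gives \<open>\<bar>u\<bar> = \<bar>f 0\<bar>\<close>,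
  the pair \<open>u, v\<close> bounds \<open>1 - \<bar>f v\<bar>\<^sup>2\<close>, and the pair \<open>v, 0\<close> then bounds \<open>\<bar>f v - f 0\<bar>\<close>.
\<close>

lemma disc_isometry_shadow:
  assumes f: "disc_isometry f" and u: "cmod u < 1" "f u = 0" and v: "cmod v < 1"
    and sep: "\<delta> \<le> cmod (u - v)" and "\<delta> > 0"
  shows "cmod (f v - f 0) \<le> (1 - (cmod (f 0))\<^sup>2) / \<delta>"
proof -
  define U V where "U = 1 - (cmod u)\<^sup>2" and "V = 1 - (cmod v)\<^sup>2"
  define A B where "A = 1 - (cmod (f 0))\<^sup>2" and "B = 1 - (cmod (f v))\<^sup>2"
  have in_disc: "cmod (f 0) < 1" "cmod (f v) < 1" using f v by (auto simp: disc_isometry_def)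
  have pos: "U > 0" "V > 0" "A > 0" "B > 0"
    using u v in_disc by (auto simp: U_def V_def A_def B_def abs_square_less_1)
  have r: "invariant_ratio (f z) (f w) = invariant_ratio z w" if "cmod z < 1" "cmod w < 1" for z w
    using f that by (auto simp: disc_isometry_def)
  have "1 / A - 1 = 1 / U - 1"
    using r[of u 0] u pos by (simp add: invariant_ratio_def A_def U_def field_simps)
  then have AU: "A = U" using pos by (simp add: field_simps)
  define D where "D = (cmod (u - v))\<^sup>2"
  have D: "D \<ge> \<delta>\<^sup>2" "D > 0" using sep \<open>\<delta> > 0\<close> by (auto simp: D_def intro: power_mono)
  have "1 / B - 1 = D / (A * V)"
    using r[of u v] u v pos AU
    by (simp add: invariant_ratio_def B_def V_def[symmetric] U_def[symmetric] D_def field_simps)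
  then have "B * D \<le> A * V"
    using pos D by (simp add: field_simps)
  then have B: "B \<le> A * V / D" using D by (simp add: field_simps)
  have "(cmod (f v - f 0))\<^sup>2 = A * B * ((cmod v)\<^sup>2 / V)"
    using r[of v 0] v pos by (simp add: invariant_ratio_def A_def[symmetric] B_def[symmetric] V_def[symmetric] field_simps)
  also have "\<dots> \<le> A * B * (1 / V)"
    using pos v by (intro mult_left_mono divide_right_mono) (auto simp: abs_square_le_1)
  also have "\<dots> \<le> A * (A * V / D) * (1 / V)"
    using pos B by (intro mult_right_mono mult_left_mono) auto
  also have "\<dots> = A\<^sup>2 / D" using pos by (simp add: power2_eq_square)
  also have "\<dots> \<le> A\<^sup>2 / \<delta>\<^sup>2" using D \<open>\<delta> > 0\<close> by (intro divide_left_mono) auto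
  finally have "(cmod (f v - f 0))\<^sup>2 \<le> (A / \<delta>)\<^sup>2" by (simp add: power_divide)
  then show ?thesis using pos \<open>\<delta> > 0\<close> by (auto simp: A_def[symmetric] intro: power2_le_imp_le)
qed

section \<open>Reflections\<close>

text \<open>
  Inversion in the circle around \<open>a\<close> of radius \<open>sqrt (\<bar>a\<bar>\<^sup>2 - 1)\<close>. This circle is orthogonal to
  the unit circle, so that for \<open>\<bar>a\<bar> > 1\<close> it meets the disc in a geodesic. The disc enclosed by it
  is the cap.
\<close>

definition reflection :: "complex \<Rightarrow> complex \<Rightarrow> complex" where
  "reflection a z = (a * cnj z - 1) / (cnj z - cnj a)"

definition cap :: "complex \<Rightarrow> complex set" where
  "cap a = {z. 1 + (cmod z)\<^sup>2 \<le> 2 * (a \<bullet> z)}"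

lemma cap_eq_cball: "z \<in> cap a \<longleftrightarrow> (cmod (z - a))\<^sup>2 \<le> (cmod a)\<^sup>2 - 1"
  unfolding cap_def cmod_power2 inner_complex_def mem_Collect_eq
  by (simp add: power2_eq_square algebra_simps)

lemma closed_cap: "closed (cap a)"
  unfolding cap_def by (intro closed_Collect_le continuous_intros)

context
  fixes a :: complex
  assumes a: "cmod a > 1"
begin

lemma reflection_diff:
  assumes "z \<noteq> a" "w \<noteq> a"
  shows "(cmod (reflection a z - reflection a w))\<^sup>2 =
    ((cmod a)\<^sup>2 - 1)\<^sup>2 * (cmod (z - w))\<^sup>2 / ((cmod (z - a))\<^sup>2 * (cmod (w - a))\<^sup>2)"
proof -
  have nz: "cnj z - cnj a \<noteq> 0" "cnj w - cnj a \<noteq> 0" using assms by auto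
  have "reflection a z - reflection a w =
    (1 - a * cnj a) * (cnj z - cnj w) / ((cnj z - cnj a) * (cnj w - cnj a))"
    unfolding reflection_def using nz by (simp add: field_simps)
  also have "1 - a * cnj a = of_real (1 - (cmod a)\<^sup>2)"
    using complex_norm_square[of a] by simp
  also have "cmod (of_real (1 - (cmod a)\<^sup>2) * (cnj z - cnj w) / ((cnj z - cnj a) * (cnj w - cnj a)))
     = \<bar>1 - (cmod a)\<^sup>2\<bar> * cmod (z - w) / (cmod (z - a) * cmod (w - a))"
    by (simp only: norm_mult norm_divide norm_of_real complex_cnj_diff[symmetric] complex_mod_cnj)
  finally show ?thesis
    by (simp add: power_mult_distrib power_divide power2_commute)
qed

lemma reflection_norm:
  assumes "z \<noteq> a"
  shows "1 - (cmod (reflection a z))\<^sup>2 = ((cmod a)\<^sup>2 - 1) * (1 - (cmod z)\<^sup>2) / (cmod (z - a))\<^sup>2"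
proof -
  have "(cmod (z - a))\<^sup>2 > 0" using assms by simp
  moreover have "(cmod (z - a))\<^sup>2 - (cmod (a * cnj z - 1))\<^sup>2 = ((cmod a)\<^sup>2 - 1) * (1 - (cmod z)\<^sup>2)"
    unfolding cmod_power2 by (simp add: power2_eq_square algebra_simps)
  moreover have "(cmod (reflection a z))\<^sup>2 = (cmod (a * cnj z - 1))\<^sup>2 / (cmod (z - a))\<^sup>2"
    by (simp only: reflection_def norm_divide power_divide complex_cnj_diff[symmetric] complex_mod_cnj)
  ultimately show ?thesis by (simp add: field_simps)
qed

lemma disc_ne_center: "cmod z < 1 \<Longrightarrow> z \<noteq> a"
  using a by auto

lemma disc_isometry_reflection: "disc_isometry (reflection a)"
proof -
  have s: "(cmod a)\<^sup>2 - 1 > 0" using a by (simp add: power_gt1_lemma one_less_power)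
  have "cmod (reflection a z) < 1" if "cmod z < 1" for z
  proof -
    have "((cmod a)\<^sup>2 - 1) * (1 - (cmod z)\<^sup>2) / (cmod (z - a))\<^sup>2 > 0"
      using s that disc_ne_center[OF that] by (simp add: abs_square_less_1)
    then have "(cmod (reflection a z))\<^sup>2 < 1"
      using reflection_norm[OF disc_ne_center[OF that]] by linarith
    then show ?thesis by (simp add: abs_square_less_1)
  qed
  moreover have "invariant_ratio (reflection a z) (reflection a w) = invariant_ratio z w"
    if "cmod z < 1" "cmod w < 1" for z w
    using s disc_ne_center[OF that(1)] disc_ne_center[OF that(2)]
    by (simp add: invariant_ratio_def reflection_diff reflection_norm power2_eq_square[of "_ - 1"])
  ultimately show ?thesis by (auto simp: disc_isometry_def)
qed

lemma reflection_involution: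
  assumes "cmod z < 1"
  shows "reflection a (reflection a z) = z"
proof -
  have nz: "z - a \<noteq> 0" "cnj z - cnj a \<noteq> 0" using disc_ne_center[OF assms] by auto
  have "cmod a * cmod a > 1" using a by (metis less_1_mult)
  then have k: "a * cnj a - 1 \<noteq> 0"
    by (metis complex_mod_cnj eq_iff_diff_eq_0 less_irrefl norm_mult norm_one)
  have c: "cnj (reflection a z) = (cnj a * z - 1) / (z - a)" by (simp add: reflection_def)
  have "cnj (reflection a z) - cnj a = (a * cnj a - 1) / (z - a)"
    unfolding c using nz by (simp add: field_simps)
  moreover have "a * cnj (reflection a z) - 1 = (a * cnj a - 1) * z / (z - a)"
    unfolding c using nz by (simp add: field_simps)
  ultimately show ?thesis
    using nz k unfolding reflection_def[of a "reflection a z"] by simp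
qed

lemma reflection_in_cap:
  assumes "cmod z < 1" "z \<notin> cap a"
  shows "reflection a z \<in> cap a"
proof -
  define s where "s = (cmod a)\<^sup>2 - 1"
  have s: "s > 0" using a by (simp add: s_def one_less_power)
  have nz: "z - a \<noteq> 0" "cnj z - cnj a \<noteq> 0" using disc_ne_center[OF assms(1)] by auto
  have "reflection a z - a = of_real s / (cnj z - cnj a)"
    unfolding reflection_def s_def using nz complex_norm_square[of a] by (simp add: field_simps)
  then have "(cmod (reflection a z - a))\<^sup>2 = s\<^sup>2 / (cmod (z - a))\<^sup>2"
    by (simp only: norm_divide power_divide complex_cnj_diff[symmetric] complex_mod_cnj norm_of_real power2_abs)
  also have "\<dots> \<le> s\<^sup>2 / s"
    using assms(2) s nz unfolding cap_eq_cball s_def[symmetric]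
    by (intro divide_left_mono) (auto intro!: mult_pos_pos)
  finally show ?thesis
    using s unfolding cap_eq_cball s_def[symmetric] by (simp add: power2_eq_square)
qed

end

section \<open>An infinite family of disjoint caps\<close>

text \<open>
  Put \<open>w = (-1)\<^sup>n z\<close> and use the upper half plane coordinate \<open>i * (1 + cnj w) / (1 - cnj w)\<close>, which
  sends \<open>w = 1\<close> to infinity. Geodesics become half circles over real intervals, and the cap with
  index \<open>n\<close> is the half disc over \<open>[n + 3, n + 4]\<close>. Caps whose indices have the same parity thus
  belong to disjoint intervals, and the offset 3 keeps all caps away from the imaginary axis.
\<close>

definition center :: "nat \<Rightarrow> complex" where
  "center n = (let m = real n + 3 in
     (-1) ^ n * Complex ((m * (m + 1) - 1) / (m * (m + 1) + 1)) ((2 * m + 1) / (m * (m + 1) + 1)))"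

text \<open>
  Here \<open>2 * Im w / P\<close> is the real part of the upper half plane coordinate of \<open>w\<close>, so the bounds
  on \<open>Im w\<close> say that the cap lies over the interval \<open>[m, m + 1]\<close>. As \<open>m \<ge> 3\<close>, the modulus of the
  coordinate is then at least 3, which in the disc is the bound on \<open>Re w\<close>.
\<close>

lemma cap_center_bounds:
  fixes m :: real
  assumes "m = real n + 3" "z \<in> cap (center n)"
  defines "w \<equiv> (-1) ^ n * z"
  defines "P \<equiv> (cmod (w - 1))\<^sup>2"
  shows "P > 0" "m * P \<le> 2 * Im w" "2 * Im w \<le> (m + 1) * P" "Re w \<ge> 2/5"
proof -
  define M where "M = m * (m + 1)"
  have m: "m \<ge> 3" using assms(1) by simp
  then have "m * (m + 1) \<ge> 0" by simp
  then have M: "M + 1 > 0" by (simp add: M_def)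
  define x y where "x = Re w" and "y = Im w"
  define Q where "Q = (x + 1)\<^sup>2 + y\<^sup>2"
  have P: "P = (x - 1)\<^sup>2 + y\<^sup>2" by (simp add: P_def cmod_power2 x_def y_def)
  have nw: "(cmod z)\<^sup>2 = x\<^sup>2 + y\<^sup>2"
    unfolding x_def y_def cmod_power2[symmetric] by (simp add: w_def norm_mult norm_power)
  define p q where "p = (M - 1) / (M + 1)" and "q = (2 * m + 1) / (M + 1)"
  have "center n = (-1) ^ n * Complex p q"
    by (simp add: center_def Let_def assms(1)[symmetric] M_def p_def q_def)
  then have "center n \<bullet> z = p * x + q * y"
    by (cases "even n") (simp_all add: inner_complex_def w_def x_def y_def)
  also have "\<dots> = ((M - 1) * x + (2 * m + 1) * y) / (M + 1)"
    by (simp add: p_def q_def add_divide_distrib[symmetric])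
  finally have cz: "center n \<bullet> z = ((M - 1) * x + (2 * m + 1) * y) / (M + 1)" .
  have "(1 + (x\<^sup>2 + y\<^sup>2)) * (M + 1) \<le> 2 * ((M - 1) * x + (2 * m + 1) * y)"
  proof -
    have "1 + (x\<^sup>2 + y\<^sup>2) \<le> 2 * ((M - 1) * x + (2 * m + 1) * y) / (M + 1)"
      using assms(2) unfolding cap_def by (simp add: nw cz)
    then show ?thesis using M by (simp only: pos_le_divide_eq)
  qed
  then have main: "M * P + Q \<le> (2 * m + 1) * (2 * y)"
    by (simp add: P Q_def power2_eq_square algebra_simps)
  \<comment> \<open>\<open>Q / P\<close> is the squared modulus of the half plane coordinate and \<open>2 * y / P\<close> its real part.\<close>
  have PQ: "(2 * y)\<^sup>2 \<le> P * Q"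
  proof -
    have "P * Q - (2 * y)\<^sup>2 = (1 - x\<^sup>2 - y\<^sup>2)\<^sup>2"
      by (simp add: P Q_def power2_eq_square algebra_simps)
    then show ?thesis by (smt (verit) zero_le_power2)
  qed
  have "P \<noteq> 0"
  proof
    assume "P = 0"
    then have "y = 0" "x = 1" using sum_power2_eq_zero_iff[of "x - 1" y] by (auto simp: P)
    then show False using main \<open>P = 0\<close> by (simp add: Q_def)
  qed
  then show "P > 0" by (simp add: P_def)
  have "M * P * P + (2 * y)\<^sup>2 \<le> (2 * m + 1) * (2 * y) * P"
  proof -
    have "(M * P + Q) * P \<le> ((2 * m + 1) * (2 * y)) * P" using main \<open>P > 0\<close> by (intro mult_right_mono) auto
    then show ?thesis using PQ by (simp add: algebra_simps)
  qed
  then have "(2 * y - m * P) * (2 * y - (m + 1) * P) \<le> 0"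
    by (simp add: M_def power2_eq_square algebra_simps)
  moreover define d where "d = 2 * y - m * P"
  moreover have eq: "2 * y - (m + 1) * P = d - P" by (simp add: d_def distrib_right)
  ultimately have "d * (d - P) \<le> 0" by simp
  then have "\<not> d < 0" "\<not> P < d"
    using \<open>P > 0\<close> mult_neg_neg[of d "d - P"] mult_pos_pos[of d "d - P"] by fastforce+
  then have "m * P \<le> 2 * y" "2 * y \<le> (m + 1) * P" using eq d_def by linarith+
  then show y: "m * P \<le> 2 * Im w" "2 * Im w \<le> (m + 1) * P" by (auto simp: y_def)
  have "3 * P \<le> m * P" using m \<open>P > 0\<close> by simp
  then have "3 * P \<le> 2 * y" using y by (simp add: y_def)
  then have "(3 * P)\<^sup>2 \<le> (2 * y)\<^sup>2" using \<open>P > 0\<close> by (intro power_mono) auto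
  then have "P * (9 * P) \<le> P * Q" using PQ by (simp add: power2_eq_square algebra_simps)
  then have "9 * P \<le> Q" using \<open>P > 0\<close> by simp
  then have "8 * (1 + x\<^sup>2 + y\<^sup>2) \<le> 20 * x" by (simp add: P Q_def power2_eq_square algebra_simps)
  moreover have "8 * 1 \<le> 8 * (1 + x\<^sup>2 + y\<^sup>2)" by simp
  ultimately have "8 \<le> 20 * x" by linarith
  then show "Re w \<ge> 2/5" by (simp add: x_def)
qed

lemma center_outside: "cmod (center n) > 1"
proof -
  define m where "m = real n + 3"
  have "m > 0" by (simp add: m_def)
  then have p: "m * (m + 1) + 1 > 0" by (simp add: add_pos_pos)
  have "(cmod (center n))\<^sup>2 = ((m * (m + 1) - 1)\<^sup>2 + (2 * m + 1)\<^sup>2) / (m * (m + 1) + 1)\<^sup>2"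
    unfolding center_def Let_def m_def[symmetric] norm_mult norm_power power_mult_distrib cmod_power2
    by (simp add: power_divide add_divide_distrib[symmetric])
  also have "(m * (m + 1) - 1)\<^sup>2 + (2 * m + 1)\<^sup>2 = (m * (m + 1) + 1)\<^sup>2 + 1"
    by (simp add: power2_eq_square algebra_simps)
  finally have "(cmod (center n))\<^sup>2 = 1 + 1 / (m * (m + 1) + 1)\<^sup>2"
    using p by (simp add: add_divide_distrib)
  then have "(cmod (center n))\<^sup>2 > 1" using p by simp
  then show ?thesis by (metis abs_norm_cancel abs_square_le_1 not_le)
qed

lemma caps_disjoint:
  assumes "i \<noteq> j"
  shows "cap (center i) \<inter> cap (center j) = {}"
proof -
  have False if "i < j" "z \<in> cap (center i)" "z \<in> cap (center j)" for i j z
  proof (cases "even i = even j")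
    case True
    then have eq: "(-1::complex) ^ j = (-1) ^ i" by (cases "even i") auto
    define P where "P = (cmod ((-1) ^ i * z - 1))\<^sup>2"
    define y where "y = 2 * Im ((-1) ^ i * z)"
    note b = cap_center_bounds[OF refl that(2), folded P_def y_def]
      cap_center_bounds[OF refl that(3), unfolded eq, folded P_def y_def]
    have "real i + 2 \<le> real j" using that(1) True by (cases "j = Suc i") auto
    then have "(real i + 3 + 1) * P < (real j + 3) * P" using b(1) by (intro mult_strict_right_mono) auto
    then show False using b by linarith
  next
    case False
    then have "(-1::complex) ^ j * z = - ((-1) ^ i * z)" by (cases "even i") auto
    then show False
      using cap_center_bounds(4)[OF refl that(2)] cap_center_bounds(4)[OF refl that(3)] by simp
  qed
  then show ?thesis using assms by (metis disjoint_iff linorder_neq_iff)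
qed

lemma norm_ge_in_cap: "z \<in> cap (center n) \<Longrightarrow> cmod z \<ge> 2/5"
proof -
  assume z: "z \<in> cap (center n)"
  have "cmod z = cmod ((-1) ^ n * z)" by (simp add: norm_mult norm_power)
  then show ?thesis
    using cap_center_bounds(4)[OF refl z] complex_Re_le_cmod[of "(-1) ^ n * z"] by linarith
qed

lemma consecutive_caps_separated:
  assumes u: "u \<in> cap (center n)" and v: "v \<in> cap (center (Suc n))"
  shows "4/5 \<le> cmod (u - v)"
proof -
  have "cmod (u - v) = cmod ((-1) ^ n * (u - v))" by (simp add: norm_mult norm_power)
  moreover have "Re ((-1) ^ n * (u - v)) \<ge> 4/5"
    using cap_center_bounds(4)[OF refl u] cap_center_bounds(4)[OF refl v] by (simp add: right_diff_distrib)
  ultimately show ?thesis using complex_Re_le_cmod[of "(-1) ^ n * (u - v)"] by linarith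
qed

section \<open>Words in the reflections\<close>

definition word_action :: "nat list \<Rightarrow> complex \<Rightarrow> complex" where
  "word_action w = foldr (\<lambda>n. reflection (center n)) w"

lemma word_action_Nil [simp]: "word_action [] z = z"
  and word_action_Cons [simp]: "word_action (n # w) z = reflection (center n) (word_action w z)"
  and word_action_append: "word_action (v @ w) z = word_action v (word_action w z)"
  by (simp_all add: word_action_def)

lemma disc_isometry_word_action: "disc_isometry (word_action w)"
proof (induction w)
  case Nil
  then show ?case by (simp add: disc_isometry_def)
next
  case (Cons n w)
  then show ?case
    using disc_isometry_reflection[OF center_outside[of n]] by (simp add: disc_isometry_def)
qed

lemma word_action_in_disc: "cmod z < 1 \<Longrightarrow> cmod (word_action w z) < 1"
  using disc_isometry_word_action by (simp add: disc_isometry_def)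

lemma word_action_rev: "cmod z < 1 \<Longrightarrow> word_action (rev w) (word_action w z) = z"
  by (induction w) (simp_all add: word_action_append reflection_involution center_outside word_action_in_disc)

lemma word_action_rev': "cmod z < 1 \<Longrightarrow> word_action w (word_action (rev w) z) = z"
  using word_action_rev[of z "rev w"] by simp

text \<open>
  Each reflection maps everything outside its own cap into its cap, and the base point and the
  other caps lie outside.
\<close>

lemma ping_pong:
  "distinct_adj w \<Longrightarrow> w \<noteq> [] \<Longrightarrow> word_action w 0 \<in> cap (center (hd w))"
proof (induction w)
  case (Cons n w)
  have "word_action w 0 \<notin> cap (center n)"
  proof (cases "w = []")
    case True
    then show ?thesis by (simp add: cap_def)
  next
    case False
    then have "word_action w 0 \<in> cap (center (hd w))" "hd w \<noteq> n"
      using Cons by (auto simp: distinct_adj_Cons)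
    then show ?thesis using caps_disjoint by blast
  qed
  then show ?case
    by (simp add: reflection_in_cap center_outside word_action_in_disc)
qed simp

lemma free_orbit:
  "distinct_adj u \<Longrightarrow> distinct_adj v \<Longrightarrow> word_action u 0 = word_action v 0 \<Longrightarrow> u = v"
proof (induction u arbitrary: v)
  case Nil
  then show ?case using ping_pong[of v] by (auto simp: cap_def)
next
  case (Cons n u)
  show ?case
  proof (cases v)
    case Nil
    then show ?thesis using ping_pong[of "n # u"] Cons.prems by (simp add: cap_def)
  next
    case (Cons m w)
    have "m = n"
      using ping_pong[of "n # u"] ping_pong[of v] caps_disjoint[of m n] Cons.prems Cons by auto
    moreover have "reflection (center n) (word_action (n # u) 0) = reflection (center n) (word_action v 0)"
      using Cons.prems by simp
    ultimately have "word_action u 0 = word_action w 0"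
      unfolding Cons by (simp add: reflection_involution center_outside word_action_in_disc)
    then show ?thesis
      using Cons.IH[of w] Cons.prems Cons \<open>m = n\<close> by (auto dest: distinct_adj_ConsD)
  qed
qed

section \<open>Groups generated by blocks\<close>

text \<open>
  A subgroup is described by an involution \<open>\<sigma>\<close> of the letters. Its generators are the products
  \<open>\<rho>\<^sub>n \<rho>\<^bsub>\<sigma> n\<^esub>\<close>, replaced by the single reflection \<open>\<rho>\<^sub>n\<close> if \<open>n\<close> is a fixed point. The identity
  gives the whole reflection group.
\<close>

definition block :: "(nat \<Rightarrow> nat) \<Rightarrow> nat \<Rightarrow> nat list" where
  "block \<sigma> n = (if \<sigma> n = n then [n] else [n, \<sigma> n])"

definition block_words :: "(nat \<Rightarrow> nat) \<Rightarrow> nat list set" where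
  "block_words \<sigma> = range (\<lambda>ns. concat (map (block \<sigma>) ns))"

definition word_group :: "(nat \<Rightarrow> nat) \<Rightarrow> ((nat \<Rightarrow> real) \<Rightarrow> (nat \<Rightarrow> real)) set" where
  "word_group \<sigma> = (\<lambda>w. disc_map (word_action w)) ` block_words \<sigma>"

lemma Nil_in_block_words: "[] \<in> block_words \<sigma>"
  unfolding block_words_def by (rule range_eqI[of _ _ "[]"]) simp

lemma append_in_block_words: "v \<in> block_words \<sigma> \<Longrightarrow> w \<in> block_words \<sigma> \<Longrightarrow> v @ w \<in> block_words \<sigma>"
proof -
  assume "v \<in> block_words \<sigma>" "w \<in> block_words \<sigma>"
  then obtain ns ms where "v = concat (map (block \<sigma>) ns)" "w = concat (map (block \<sigma>) ms)"
    unfolding block_words_def by blast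
  then have "v @ w = concat (map (block \<sigma>) (ns @ ms))" by simp
  then show ?thesis unfolding block_words_def by blast
qed

lemma block_in_block_words: "block \<sigma> n \<in> block_words \<sigma>"
  unfolding block_words_def by (rule range_eqI[of _ _ "[n]"]) simp

lemma block_words_cases:
  assumes "w \<in> block_words \<sigma>" "w \<noteq> []"
  obtains n v where "w = block \<sigma> n @ v" "v \<in> block_words \<sigma>"
proof -
  obtain ns where "w = concat (map (block \<sigma>) ns)" using assms(1) unfolding block_words_def by blast
  with assms(2) that show ?thesis by (cases ns) (auto simp: block_words_def)
qed

lemma block_words_id: "block_words id = UNIV"
proof -
  have "w = concat (map (block id) w)" for w by (induction w) (simp_all add: block_def)
  then show ?thesis unfolding block_words_def by blast
qed

lemma disc_map_word_in_Isom: "disc_map (word_action w) \<in> carrier (Isom 2)"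
  by (rule disc_map_in_Isom[OF disc_isometry_word_action disc_isometry_word_action[of "rev w"]])
    (simp_all add: word_action_rev word_action_rev')

lemma word_group_id_superset: "word_group \<sigma> \<subseteq> word_group id"
  unfolding word_group_def block_words_id by blast

context
  fixes \<sigma> :: "nat \<Rightarrow> nat"
  assumes invol: "\<And>n. \<sigma> (\<sigma> n) = n"
begin

lemma rev_block: "rev (block \<sigma> n) = block \<sigma> (\<sigma> n)"
  by (auto simp: block_def invol)

lemma rev_in_block_words: "w \<in> block_words \<sigma> \<Longrightarrow> rev w \<in> block_words \<sigma>"
proof -
  assume "w \<in> block_words \<sigma>"
  then obtain ns where "w = concat (map (block \<sigma>) ns)" unfolding block_words_def by blast
  then have "rev w = concat (map (block \<sigma>) (map \<sigma> (rev ns)))"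
    by (simp add: rev_concat rev_map o_def rev_block)
  then show ?thesis unfolding block_words_def by blast
qed

lemma subgroup_word_group: "subgroup (word_group \<sigma>) (Isom 2)"
proof -
  interpret group "Isom 2" by (rule group_Isom)
  have mult: "disc_map (word_action v) \<otimes>\<^bsub>Isom 2\<^esub> disc_map (word_action w) = disc_map (word_action (v @ w))" for v w
    by (simp add: disc_map_mult disc_map_word_in_Isom disc_isometry_word_action fun_eq_iff[of "_ \<circ> _"]
        word_action_append disc_map_cong[of "_ \<circ> _" "word_action (v @ w)"])
  have inv: "inv\<^bsub>Isom 2\<^esub> disc_map (word_action w) = disc_map (word_action (rev w))" for w
  proof (rule inv_equality)
    show "disc_map (word_action (rev w)) \<otimes>\<^bsub>Isom 2\<^esub> disc_map (word_action w) = \<one>\<^bsub>Isom 2\<^esub>"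
      unfolding mult one_Isom_eq by (rule disc_map_cong) (simp add: word_action_append word_action_rev)
  qed (simp_all add: disc_map_word_in_Isom)
  show ?thesis
  proof (rule subgroupI)
    show "word_group \<sigma> \<subseteq> carrier (Isom 2)" by (auto simp: word_group_def disc_map_word_in_Isom)
    show "word_group \<sigma> \<noteq> {}" using Nil_in_block_words by (auto simp: word_group_def)
  next
    fix g assume "g \<in> word_group \<sigma>"
    then show "inv\<^bsub>Isom 2\<^esub> g \<in> word_group \<sigma>"
      by (auto simp: word_group_def inv intro: rev_in_block_words)
  next
    fix g h assume "g \<in> word_group \<sigma>" "h \<in> word_group \<sigma>"
    then show "g \<otimes>\<^bsub>Isom 2\<^esub> h \<in> word_group \<sigma>"
      by (auto simp: word_group_def mult intro: append_in_block_words)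
  qed
qed

text \<open>
  Reduction respects blocks. If the block of \<open>n\<close> meets an equal letter \<open>\<sigma> n\<close> at the start of the
  following block, then that block is the one of \<open>\<sigma> n\<close>, which is the inverse, and both cancel
  completely.
\<close>

lemma reduced_block_word:
  assumes "w \<in> block_words \<sigma>"
  obtains v where "v \<in> block_words \<sigma>" "distinct_adj v"
    "\<And>z. cmod z < 1 \<Longrightarrow> word_action v z = word_action w z"
proof -
  have "\<exists>ms. distinct_adj (concat (map (block \<sigma>) ms)) \<and>
    (\<forall>z. cmod z < 1 \<longrightarrow> word_action (concat (map (block \<sigma>) ms)) z = word_action (concat (map (block \<sigma>) ns)) z)"
    for ns
  proof (induction ns)
    case Nil
    show ?case by (rule exI[of _ "[]"]) simp
  next
    case (Cons n ns)
    then obtain ms where ms: "distinct_adj (concat (map (block \<sigma>) ms))"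
      "\<And>z. cmod z < 1 \<Longrightarrow> word_action (concat (map (block \<sigma>) ms)) z = word_action (concat (map (block \<sigma>) ns)) z"
      by blast
    show ?case
    proof (cases "\<exists>ms'. ms = \<sigma> n # ms'")
      case True
      then obtain ms' where ms': "ms = \<sigma> n # ms'" by blast
      have "word_action (block \<sigma> n) (word_action (block \<sigma> (\<sigma> n)) z) = z" if "cmod z < 1" for z
        unfolding rev_block[symmetric] using word_action_rev'[OF that] .
      then have "word_action (concat (map (block \<sigma>) ms')) z = word_action (concat (map (block \<sigma>) (n # ns))) z"
        if "cmod z < 1" for z
        using that ms(2)[symmetric, OF that] by (simp add: ms' word_action_append word_action_in_disc)
      moreover have "distinct_adj (concat (map (block \<sigma>) ms'))"
        using ms(1) by (auto simp: ms')
      ultimately show ?thesis by blast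
    next
      case False
      have "block \<sigma> n \<noteq> []" "distinct_adj (block \<sigma> n)" "last (block \<sigma> n) = \<sigma> n"
        by (auto simp: block_def)
      moreover have "concat (map (block \<sigma>) ms) = [] \<or> hd (concat (map (block \<sigma>) ms)) \<noteq> \<sigma> n"
        using False by (cases ms) (auto simp: block_def)
      ultimately have "distinct_adj (concat (map (block \<sigma>) (n # ms)))"
        using ms(1) by (auto simp: distinct_adj_append_iff)
      moreover have "word_action (concat (map (block \<sigma>) (n # ms))) z = word_action (concat (map (block \<sigma>) (n # ns))) z"
        if "cmod z < 1" for z
        using ms(2)[OF that] by (simp add: word_action_append)
      ultimately show ?thesis by blast
    qed
  qed
  moreover obtain ns where "w = concat (map (block \<sigma>) ns)"
    using assms unfolding block_words_def by blast
  ultimately obtain ms where "distinct_adj (concat (map (block \<sigma>) ms))"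
    "\<And>z. cmod z < 1 \<Longrightarrow> word_action (concat (map (block \<sigma>) ms)) z = word_action w z"
    by blast
  then show ?thesis using that[of "concat (map (block \<sigma>) ms)"] unfolding block_words_def by blast
qed

end

section \<open>Discreteness\<close>

text \<open>
  Translating one of two orbit points to \<open>0\<close> moves the other into a cap, and caps stay away
  from \<open>0\<close>.
\<close>

lemma orbit_separation:
  assumes "word_action u 0 \<noteq> word_action v 0"
  shows "4/25 \<le> invariant_ratio (word_action u 0) (word_action v 0)"
proof -
  obtain t where t: "distinct_adj t" "\<And>z. cmod z < 1 \<Longrightarrow> word_action t z = word_action (rev u @ v) z"
    using reduced_block_word[of id "rev u @ v"] by (auto simp: block_words_id)
  define z where "z = word_action t 0"
  have z: "z = word_action (rev u) (word_action v 0)" using t(2)[of 0] by (simp add: z_def word_action_append)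
  have "cmod z < 1" by (simp add: z_def word_action_in_disc)
  have uz: "word_action u z = word_action v 0"
    unfolding z by (simp add: word_action_rev' word_action_in_disc)
  then have "t \<noteq> []" using assms by (auto simp: z_def)
  then have "2/5 \<le> cmod z"
    unfolding z_def by (intro norm_ge_in_cap[OF ping_pong[OF t(1)]])
  then have "(2/5)\<^sup>2 \<le> (cmod z)\<^sup>2" by (intro power_mono) auto
  also have "\<dots> \<le> (cmod z)\<^sup>2 / (1 - (cmod z)\<^sup>2)"
    using \<open>cmod z < 1\<close> by (simp add: le_divide_eq abs_square_less_1 mult_left_le)
  also have "\<dots> = invariant_ratio (word_action u 0) (word_action u z)"
    using disc_isometry_word_action[of u] \<open>cmod z < 1\<close> by (simp add: disc_isometry_def invariant_ratio_0)
  finally show ?thesis by (simp add: uz power2_eq_square)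
qed

text \<open>
  On a smaller disc the Euclidean and the hyperbolic metric are comparable, so there the orbit is
  uniformly discrete and bounded. Freeness transfers finiteness from orbit points to words.
\<close>

lemma finite_reduced_words_in_disc:
  assumes "r < 1"
  shows "finite {w. distinct_adj w \<and> cmod (word_action w 0) \<le> r}" (is "finite ?W")
proof (cases "0 \<le> r")
  case True
  define e where "e = 1 - r\<^sup>2"
  have e: "e > 0" using True assms by (simp add: e_def abs_square_less_1)
  define S where "S = (\<lambda>w. word_action w 0) ` ?W"
  have "2/5 * e \<le> dist z w" if "z \<in> S" "w \<in> S" "z \<noteq> w" for z w
  proof -
    have *: "e \<le> 1 - (cmod x)\<^sup>2" if "x \<in> S" for x
      using that by (auto simp: S_def e_def intro: power_mono)
    have pos: "1 - (cmod z)\<^sup>2 > 0" "1 - (cmod w)\<^sup>2 > 0"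
      using *[OF that(1)] *[OF that(2)] e by linarith+
    have "4/25 \<le> invariant_ratio z w"
      using that orbit_separation by (auto simp: S_def)
    then have "4/25 * ((1 - (cmod z)\<^sup>2) * (1 - (cmod w)\<^sup>2)) \<le> (cmod (z - w))\<^sup>2"
      unfolding invariant_ratio_def using mult_pos_pos[OF pos] by (simp only: pos_le_divide_eq)
    moreover have "e * e \<le> (1 - (cmod z)\<^sup>2) * (1 - (cmod w)\<^sup>2)"
      using *[OF that(1)] *[OF that(2)] e by (intro mult_mono) auto
    ultimately have "(2/5 * e)\<^sup>2 \<le> (cmod (z - w))\<^sup>2"
      by (simp add: power2_eq_square)
    then show ?thesis unfolding dist_norm by (rule power2_le_imp_le) simp
  qed
  then have "uniform_discrete S"
    unfolding uniform_discrete_def using e by (intro exI[of _ "2/5 * e"]) (meson linorder_not_less mult_pos_pos zero_less_divide_iff zero_less_numeral)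
  moreover have "bounded S" unfolding S_def by (intro boundedI[of _ r]) auto
  ultimately have "finite S" using uniform_discrete_finite_iff by blast
  moreover have "inj_on (\<lambda>w. word_action w 0) ?W"
    by (auto intro!: inj_onI free_orbit)
  ultimately show ?thesis unfolding S_def by (rule finite_imageD)
next
  case False
  then have "\<not> cmod z \<le> r" for z using norm_ge_zero[of z] by linarith
  then show ?thesis by simp
qed

lemma discrete_word_group: "discrete_isom 2 (word_group id)"
  unfolding discrete_isom_def
proof (intro allI impI)
  fix R :: real
  define k where "k = (cosh R - 1) / 2"
  have k: "k \<ge> 0" using cosh_real_ge_1[of R] by (simp add: k_def)
  define r where "r = sqrt (k / (1 + k))"
  have "r < 1" using k by (simp add: r_def real_sqrt_lt_1_iff)
  \<comment> \<open>The hyperbolic ball of radius \<open>R\<close> around \<open>0\<close> is the Euclidean disc of radius \<open>r = tanh (R/2)\<close>.\<close>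
  have "g \<in> (\<lambda>w. disc_map (word_action w)) ` {w. distinct_adj w \<and> cmod (word_action w 0) \<le> r}"
    if gG: "g \<in> word_group id" and gR: "hyp_dist 2 base_point (g base_point) \<le> R" for g
  proof -
    obtain u where "g = disc_map (word_action u)"
      using gG by (auto simp: word_group_def)
    moreover obtain w where w: "distinct_adj w" "\<And>z. cmod z < 1 \<Longrightarrow> word_action w z = word_action u z"
      using reduced_block_word[of id u] by (auto simp: block_words_id)
    ultimately have g: "g = disc_map (word_action w)" by (auto intro: disc_map_cong)
    define q where "q = (cmod (word_action w 0))\<^sup>2"
    have q: "0 \<le> q" "q < 1" by (auto simp: q_def abs_square_less_1 word_action_in_disc)
    have "arcosh (1 + 2 * (q / (1 - q))) \<le> R"
      using gR by (simp add: g base_point_eq disc_map_to_plane hyp_dist_to_plane invariant_ratio_0 q_def)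
    moreover have "arcosh (1 + 2 * (q / (1 - q))) \<ge> 0" using q by simp
    ultimately have "cosh (arcosh (1 + 2 * (q / (1 - q)))) \<le> cosh R"
      by (subst cosh_real_nonneg_le_iff) auto
    then have "1 + 2 * (q / (1 - q)) \<le> cosh R" using q by simp
    then have "q / (1 - q) \<le> k" unfolding k_def le_divide_eq_numeral1 by (simp add: mult.commute le_diff_eq add.commute)
    then have "q \<le> k / (1 + k)" using q k by (simp add: field_simps)
    then have "cmod (word_action w 0) \<le> r"
      unfolding r_def q_def by (rule real_le_rsqrt)
    then show ?thesis using g w(1) by blast
  qed
  then have "{g \<in> word_group id. hyp_dist 2 base_point (g base_point) \<le> R} \<subseteq>
      (\<lambda>w. disc_map (word_action w)) ` {w. distinct_adj w \<and> cmod (word_action w 0) \<le> r}"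
    by blast
  then show "finite {g \<in> word_group id. hyp_dist 2 base_point (g base_point) \<le> R}"
    by (rule finite_subset) (intro finite_imageI finite_reduced_words_in_disc \<open>r < 1\<close>)
qed

section \<open>Limit points of orbits\<close>

lemma orbit_norm_tendsto_1:
  assumes "inj f" "\<And>n. distinct_adj (f n)"
  shows "(\<lambda>n. cmod (word_action (f n) 0)) \<longlonglongrightarrow> 1"
proof (rule order_tendstoI)
  fix r :: real assume "r < 1"
  have "finite (f -` {w. distinct_adj w \<and> cmod (word_action w 0) \<le> r})"
    using finite_reduced_words_in_disc[OF \<open>r < 1\<close>] assms(1) by (rule finite_vimageI)
  then have "\<forall>\<^sub>F n in sequentially. n \<notin> f -` {w. distinct_adj w \<and> cmod (word_action w 0) \<le> r}"
    unfolding cofinite_eq_sequentially[symmetric] eventually_cofinite by simp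
  then show "\<forall>\<^sub>F n in sequentially. r < cmod (word_action (f n) 0)"
    by eventually_elim (use assms(2) in auto)
next
  fix r :: real assume "1 < r"
  then show "\<forall>\<^sub>F n in sequentially. cmod (word_action (f n) 0) < r"
    using less_trans[OF word_action_in_disc[of 0]] by (simp add: always_eventually)
qed

lemma infinite_orbit_limit_point:
  assumes "infinite S" "\<And>w. w \<in> S \<Longrightarrow> distinct_adj w"
  obtains f \<xi> where "inj f" "range f \<subseteq> S" "(\<lambda>n. word_action (f n) 0) \<longlonglongrightarrow> \<xi>" "cmod \<xi> = 1"
proof -
  obtain f :: "nat \<Rightarrow> nat list" where f: "inj f" "range f \<subseteq> S"
    using infinite_countable_subset[OF assms(1)] by blast
  have "bounded (range (\<lambda>n. word_action (f n) 0))"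
    by (intro boundedI[of _ 1]) (auto intro: less_imp_le simp: word_action_in_disc)
  then obtain \<xi> \<rho> where \<rho>: "strict_mono \<rho>" "((\<lambda>n. word_action (f n) 0) \<circ> \<rho>) \<longlonglongrightarrow> \<xi>"
    using bounded_imp_convergent_subsequence by blast
  have inj: "inj (f \<circ> \<rho>)" using f(1) \<rho>(1) by (intro inj_compose strict_mono_imp_inj_on)
  have lim: "(\<lambda>n. word_action ((f \<circ> \<rho>) n) 0) \<longlonglongrightarrow> \<xi>" using \<rho>(2) by (simp add: o_def)
  have "(\<lambda>n. cmod (word_action ((f \<circ> \<rho>) n) 0)) \<longlonglongrightarrow> 1"
    using f(2) assms(2) by (intro orbit_norm_tendsto_1 inj) auto
  then have "cmod \<xi> = 1" using tendsto_norm[OF lim] LIMSEQ_unique by blast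
  then show ?thesis using that[OF inj _ lim] f(2) by auto
qed

lemma limit_set_word_groupI:
  assumes "\<And>n. f n \<in> block_words \<sigma>" "(\<lambda>n. word_action (f n) 0) \<longlonglongrightarrow> \<xi>" "cmod \<xi> = 1"
  shows "to_plane \<xi> \<in> limit_set 2 (word_group \<sigma>)"
proof -
  have "limitin (Euclidean_space 2) (\<lambda>n. disc_map (word_action (f n)) base_point) (to_plane \<xi>) sequentially"
    using assms(2) by (simp add: base_point_eq disc_map_to_plane limitin_to_plane)
  then show ?thesis
    using assms(1,3) unfolding limit_set_def word_group_def
    by (intro CollectI conjI exI[of _ "\<lambda>n. disc_map (word_action (f n))"]) auto
qed

text \<open>
  The block of \<open>j\<close> can be followed by the block of any letter other than \<open>\<sigma> j\<close> without
  cancellation. This yields infinitely many reduced words that start with \<open>j\<close>, whose orbit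
  points accumulate in the closed cap.
\<close>

lemma limit_point_in_cap:
  assumes invol: "\<And>n. \<sigma> (\<sigma> n) = n"
  obtains \<xi> where "\<xi> \<in> cap (center j)" "to_plane \<xi> \<in> limit_set 2 (word_group \<sigma>)"
proof -
  define h where "h m = block \<sigma> j @ block \<sigma> m" for m
  have b: "block \<sigma> m \<noteq> []" "hd (block \<sigma> m) = m" "distinct_adj (block \<sigma> m)" "last (block \<sigma> m) = \<sigma> m" for m
    by (auto simp: block_def)
  have "inj h"
    using b(2) by (metis (no_types, lifting) h_def injI same_append_eq)
  then have "infinite (h ` (- {\<sigma> j}))"
    using finite_imageD[of h "- {\<sigma> j}"] infinite_UNIV_nat by (auto simp: finite_compl dest: inj_on_subset)
  moreover have red: "distinct_adj w" if "w \<in> h ` (- {\<sigma> j})" for w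
    using that b by (auto simp: h_def distinct_adj_append_iff)
  ultimately obtain f \<xi> where f: "inj f" "range f \<subseteq> h ` (- {\<sigma> j})"
      "(\<lambda>n. word_action (f n) 0) \<longlonglongrightarrow> \<xi>" "cmod \<xi> = 1"
    by (rule infinite_orbit_limit_point)
  have "f n \<in> h ` (- {\<sigma> j})" for n using f(2) by blast
  moreover have "word_action w 0 \<in> cap (center j) \<and> w \<in> block_words \<sigma>" if "w \<in> h ` (- {\<sigma> j})" for w
  proof -
    obtain m where w: "w = block \<sigma> j @ block \<sigma> m" using \<open>w \<in> _\<close> by (auto simp: h_def)
    have "w \<noteq> []" "hd w = j" using b[of j] by (simp_all add: w)
    then show ?thesis
      using ping_pong[OF red[OF that]] by (simp add: w append_in_block_words block_in_block_words)
  qed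
  ultimately have "word_action (f n) 0 \<in> cap (center j)" "f n \<in> block_words \<sigma>" for n
    by blast+
  then show ?thesis
    using that[of \<xi>] closed_sequentially[OF closed_cap _ f(3)] limit_set_word_groupI[OF _ f(3,4)] by blast
qed

lemma non_elementary_word_group:
  assumes "\<And>n. \<sigma> (\<sigma> n) = n"
  shows "non_elementary 2 (word_group \<sigma>)"
proof -
  have "\<exists>\<xi>. \<xi> \<in> cap (center j) \<and> to_plane \<xi> \<in> limit_set 2 (word_group \<sigma>)" for j
    using limit_point_in_cap[of \<sigma> j] assms by blast
  then obtain \<xi> where \<xi>: "\<And>j. \<xi> j \<in> cap (center j)" "\<And>j. to_plane (\<xi> j) \<in> limit_set 2 (word_group \<sigma>)"
    by metis
  have "inj (\<lambda>j. to_plane (\<xi> j))"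
  proof (rule injI)
    fix i j assume "to_plane (\<xi> i) = to_plane (\<xi> j)"
    then have "\<xi> i \<in> cap (center i) \<inter> cap (center j)" using \<xi>(1)[of i] \<xi>(1)[of j] by simp
    then show "i = j" using caps_disjoint[of i j] by (cases "i = j") simp_all
  qed
  then have "card ((\<lambda>j. to_plane (\<xi> j)) ` {..<3}) = 3"
    by (subst card_image) (auto intro: inj_on_subset)
  then show ?thesis unfolding non_elementary_def
    by (intro exI[of _ "(\<lambda>j. to_plane (\<xi> j)) ` {..<3}"]) (use \<xi>(2) in auto)
qed

section \<open>The common radial limit point\<close>

text \<open>
  Seen from the prefix of length \<open>n\<close>, the base point is in the cap of \<open>n - 1\<close> and the longer
  prefix in the cap of \<open>n\<close>. These caps have Euclidean distance at least \<open>4/5\<close>.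
\<close>

lemma prefix_shadow:
  assumes "0 < n" "n < m"
  shows "cmod (word_action [0..<m] 0 - word_action [0..<n] 0) \<le> 5/2 * (1 - cmod (word_action [0..<n] 0))"
proof -
  define u v where "u = word_action (rev [0..<n]) 0" and "v = word_action [n..<m] 0"
  have adj: "distinct_adj [i..<k]" for i k by (simp add: distinct_adj_conv_nth)
  have "u \<in> cap (center (n - 1))"
    using ping_pong[of "rev [0..<n]"] adj[of 0 n] assms(1) by (simp add: u_def hd_rev last_upt)
  moreover have "v \<in> cap (center n)"
    using ping_pong[of "[n..<m]"] adj[of n m] assms(2) by (simp add: v_def)
  ultimately have sep: "4/5 \<le> cmod (u - v)"
    using consecutive_caps_separated[of u "n - 1" v] assms(1) by simp
  define c where "c = cmod (word_action [0..<n] 0)"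
  have c: "0 \<le> c" "c < 1" by (simp_all add: c_def word_action_in_disc)
  have "word_action [0..<m] 0 = word_action [0..<n] v"
    using assms(2) upt_add_eq_append[of 0 n "m - n"] by (simp add: v_def word_action_append)
  then have "cmod (word_action [0..<m] 0 - word_action [0..<n] 0) \<le> (1 - c\<^sup>2) / (4/5)"
    using disc_isometry_shadow[OF disc_isometry_word_action, of u "[0..<n]" v "4/5"] sep
    by (simp add: c_def u_def v_def word_action_in_disc word_action_rev')
  also have "\<dots> \<le> 5/2 * (1 - c)"
  proof -
    have "1 - c\<^sup>2 = 2 * (1 - c) - (1 - c)\<^sup>2" by (simp add: power2_eq_square algebra_simps)
    then have "1 - c\<^sup>2 \<le> 2 * (1 - c)" by simp
    then show ?thesis by simp
  qed
  finally show ?thesis by (simp add: c_def)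
qed

text \<open>
  Some subsequence of the prefixes converges to a boundary point. Letting \<open>m\<close> run through it in
  the shadow estimate puts every prefix into a Stolz angle, and since the moduli tend to \<open>1\<close>,
  the whole sequence converges.
\<close>

lemma prefixes_converge_radially:
  obtains \<eta> where "cmod \<eta> = 1" "(\<lambda>n. word_action [0..<n] 0) \<longlonglongrightarrow> \<eta>"
    "\<And>n. 0 < n \<Longrightarrow> cmod (\<eta> - word_action [0..<n] 0) \<le> 5/2 * (1 - cmod (word_action [0..<n] 0))"
proof -
  define pre where "pre n = [0..<n]" for n :: nat
  have adj: "distinct_adj (pre n)" for n by (simp add: pre_def distinct_adj_conv_nth)
  have inj: "inj pre" unfolding pre_def by (intro injI) (metis diff_zero length_upt)
  then have "infinite (range pre)" by (simp add: finite_image_iff)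
  then obtain f \<eta> where f: "inj f" "range f \<subseteq> range pre" "(\<lambda>n. word_action (f n) 0) \<longlonglongrightarrow> \<eta>" "cmod \<eta> = 1"
    using adj infinite_orbit_limit_point[of "range pre"] by blast
  have stolz: "cmod (\<eta> - word_action (pre n) 0) \<le> 5/2 * (1 - cmod (word_action (pre n) 0))" if "0 < n" for n
  proof -
    have "finite (f -` (pre ` {..n}))" using f(1) by (intro finite_vimageI) auto
    then have "\<forall>\<^sub>F k in sequentially. f k \<notin> pre ` {..n}"
      unfolding cofinite_eq_sequentially[symmetric] eventually_cofinite by (simp add: vimage_def)
    then have "\<forall>\<^sub>F k in sequentially.
        cmod (word_action (f k) 0 - word_action (pre n) 0) \<le> 5/2 * (1 - cmod (word_action (pre n) 0))"
    proof eventually_elim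
      case (elim k)
      obtain m where "f k = pre m" using f(2) by blast
      then show ?case using elim prefix_shadow[OF that, of m] unfolding pre_def by (cases "n < m") auto
    qed
    moreover have "(\<lambda>k. cmod (word_action (f k) 0 - word_action (pre n) 0)) \<longlonglongrightarrow> cmod (\<eta> - word_action (pre n) 0)"
      by (intro tendsto_intros f(3))
    ultimately show ?thesis by (intro tendsto_upperbound) auto
  qed
  have "(\<lambda>n. word_action (pre n) 0 - \<eta>) \<longlonglongrightarrow> 0"
  proof (rule Lim_null_comparison)
    show "\<forall>\<^sub>F n in sequentially. norm (word_action (pre n) 0 - \<eta>) \<le> 5/2 * (1 - cmod (word_action (pre n) 0))"
      using eventually_gt_at_top[of 0]
      by (rule eventually_mono) (subst norm_minus_commute, rule stolz)
    have "(\<lambda>n. 5/2 * (1 - cmod (word_action (pre n) 0))) \<longlonglongrightarrow> 5/2 * (1 - 1)"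
      by (intro tendsto_mult tendsto_diff tendsto_const orbit_norm_tendsto_1 inj adj)
    then show "(\<lambda>n. 5/2 * (1 - cmod (word_action (pre n) 0))) \<longlonglongrightarrow> 0" by simp
  qed
  then have "(\<lambda>n. word_action (pre n) 0) \<longlonglongrightarrow> \<eta>" by (simp add: LIM_zero_cancel)
  then show ?thesis using that f(4) stolz unfolding pre_def by blast
qed

lemma radial_limit_word_group:
  fixes \<rho> :: "nat \<Rightarrow> nat"
  assumes \<eta>: "cmod \<eta> = 1" "(\<lambda>n. word_action [0..<n] 0) \<longlonglongrightarrow> \<eta>"
      "\<And>n. 0 < n \<Longrightarrow> cmod (\<eta> - word_action [0..<n] 0) \<le> 5/2 * (1 - cmod (word_action [0..<n] 0))"
    and \<rho>: "strict_mono \<rho>" "\<And>n. 0 < \<rho> n" "\<And>n. [0..<\<rho> n] \<in> block_words \<sigma>"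
  shows "to_plane \<eta> \<in> radial_limit_set 2 (word_group \<sigma>)"
proof (rule radial_limit_setI[where g = "\<lambda>n. word_action [0..<\<rho> n]", OF \<eta>(1)])
  show "(\<lambda>n. word_action [0..<\<rho> n] 0) \<longlonglongrightarrow> \<eta>"
    using LIMSEQ_subseq_LIMSEQ[OF \<eta>(2) \<rho>(1)] by (simp add: o_def)
  show "cmod (\<eta> - word_action [0..<\<rho> n] 0) \<le> 5/2 * (1 - cmod (word_action [0..<\<rho> n] 0))" for n
    using \<eta>(3) \<rho>(2) by blast
qed (use \<rho>(3) in \<open>auto simp: word_group_def word_action_in_disc\<close>)

section \<open>Two interlaced pairings\<close>

text \<open>
  The pairings \<open>(0 1)(2 3)(4 5)\<dots>\<close> and \<open>(0)(1 2)(3 4)\<dots>\<close> belong to the two subgroups. Together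
  they link all letters into one infinite chain.
\<close>

definition even_pairing :: "nat \<Rightarrow> nat" where
  "even_pairing n = (if even n then n + 1 else n - 1)"

definition odd_pairing :: "nat \<Rightarrow> nat" where
  "odd_pairing n = (if n = 0 then 0 else if odd n then n + 1 else n - 1)"

lemma even_pairing_invol: "even_pairing (even_pairing n) = n"
  by (auto simp: even_pairing_def)

lemma odd_pairing_invol: "odd_pairing (odd_pairing n) = n"
  by (auto simp: odd_pairing_def)

lemma even_prefix_in_block_words: "[0..<2 * n] \<in> block_words even_pairing"
proof (induction n)
  case (Suc n)
  have "[0..<2 * Suc n] = [0..<2 * n] @ block even_pairing (2 * n)"
    by (simp add: block_def even_pairing_def)
  then show ?case using Suc by (metis append_in_block_words block_in_block_words)
qed (simp add: Nil_in_block_words)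

lemma odd_prefix_in_block_words: "[0..<2 * n + 1] \<in> block_words odd_pairing"
proof (induction n)
  case 0
  have "[0..<2 * 0 + 1] = block odd_pairing 0" by (simp add: block_def odd_pairing_def)
  then show ?case by (metis block_in_block_words)
next
  case (Suc n)
  have "[0..<2 * Suc n + 1] = [0..<2 * n + 1] @ block odd_pairing (2 * n + 1)"
    by (simp add: block_def odd_pairing_def)
  then show ?case using Suc by (metis append_in_block_words block_in_block_words)
qed

text \<open>
  The odd letter \<open>y\<close> must be completed to the block \<open>y, y + 1\<close> of the odd pairing. In the even
  pairing its second letter starts the block \<open>y + 1, y + 2\<close>, whose last letter is again odd
  and opens a block of the odd pairing. The situation recurs with a shorter word.
\<close>

lemma no_staircase:
  assumes "odd y" "y # w \<in> block_words odd_pairing" "w \<in> block_words even_pairing"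
  shows False
  using assms
proof (induction w arbitrary: y rule: length_induct)
  case (1 w)
  obtain n v where "y # w = block odd_pairing n @ v" and v: "v \<in> block_words odd_pairing"
    using "1.prems"(2) by (rule block_words_cases) simp
  then have w: "w = Suc y # v"
    using \<open>odd y\<close> by (auto simp: block_def odd_pairing_def split: if_splits)
  obtain k v' where "w = block even_pairing k @ v'" and v': "v' \<in> block_words even_pairing"
    using "1.prems"(3) by (rule block_words_cases) (simp add: w)
  then have "v = Suc (Suc y) # v'"
    using \<open>odd y\<close> by (auto simp: w block_def even_pairing_def split: if_splits)
  then show False using "1.IH"[rule_format, of v' "Suc (Suc y)"] v v' \<open>odd y\<close> by (simp add: w)
qed

text \<open>
  The two pairings agree nowhere, so a common word must start with the singleton block of \<open>0\<close>,
  and it enters the staircase at the letter \<open>1\<close>.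
\<close>

lemma block_words_inter: "block_words even_pairing \<inter> block_words odd_pairing = {[]}"
proof -
  have False if w: "w \<in> block_words even_pairing" "w \<in> block_words odd_pairing" "w \<noteq> []" for w
  proof -
    obtain n u where u: "w = block even_pairing n @ u" "u \<in> block_words even_pairing"
      using w(1,3) by (rule block_words_cases)
    obtain m v where v: "w = block odd_pairing m @ v" "v \<in> block_words odd_pairing"
      using w(2,3) by (rule block_words_cases)
    have "n = 0" "v = 1 # u"
      using u(1) v(1) by (auto simp: block_def even_pairing_def odd_pairing_def split: if_splits)
    then show False using no_staircase[of 1 u] u(2) v(2) by simp
  qed
  then show ?thesis using Nil_in_block_words by blast
qed

lemma word_group_inter: "word_group even_pairing \<inter> word_group odd_pairing = {\<one>\<^bsub>Isom 2\<^esub>}"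
proof -
  have one: "\<one>\<^bsub>Isom 2\<^esub> = disc_map (word_action [])"
    unfolding one_Isom_eq by (rule disc_map_cong) simp
  then have "\<one>\<^bsub>Isom 2\<^esub> \<in> word_group \<sigma>" for \<sigma>
    using Nil_in_block_words by (auto simp: word_group_def)
  moreover have "g = \<one>\<^bsub>Isom 2\<^esub>" if g: "g \<in> word_group even_pairing" "g \<in> word_group odd_pairing" for g
  proof -
    obtain u where u: "g = disc_map (word_action u)" "u \<in> block_words even_pairing"
      using g(1) by (auto simp: word_group_def)
    obtain v where v: "g = disc_map (word_action v)" "v \<in> block_words odd_pairing"
      using g(2) by (auto simp: word_group_def)
    obtain u' where u': "u' \<in> block_words even_pairing" "distinct_adj u'"
        "\<And>z. cmod z < 1 \<Longrightarrow> word_action u' z = word_action u z"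
      using reduced_block_word[of even_pairing u] even_pairing_invol u(2) by blast
    obtain v' where v': "v' \<in> block_words odd_pairing" "distinct_adj v'"
        "\<And>z. cmod z < 1 \<Longrightarrow> word_action v' z = word_action v z"
      using reduced_block_word[of odd_pairing v] odd_pairing_invol v(2) by blast
    have "disc_map (word_action u) (to_plane 0) = disc_map (word_action v) (to_plane 0)"
      using u(1) v(1) by simp
    then have "word_action u' 0 = word_action v' 0"
      using u'(3) v'(3) by (simp add: disc_map_to_plane)
    then have "u' = v'" using free_orbit u'(2) v'(2) by blast
    then have "u' = []" using u'(1) v'(1) block_words_inter by blast
    then show ?thesis using u(1) u'(3) one by (auto intro: disc_map_cong)
  qed
  ultimately show ?thesis by blast
qed

lemma limit_set_trivial: "limit_set 2 {\<one>\<^bsub>Isom 2\<^esub>} = {}"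
proof -
  have False if "\<xi> \<in> hyp_boundary 2" "\<forall>n. g n = \<one>\<^bsub>Isom 2\<^esub>"
    "limitin (Euclidean_space 2) (\<lambda>n. g n base_point) \<xi> sequentially" for g :: "nat \<Rightarrow> _" and \<xi>
  proof -
    have \<xi>: "\<xi> = to_plane (of_plane \<xi>)" "cmod (of_plane \<xi>) = 1"
      using that(1) to_plane_of_plane[of \<xi>] to_plane_mem_hyp_boundary[of "of_plane \<xi>"]
      by (simp_all add: hyp_boundary_def)
    have "limitin (Euclidean_space 2) (\<lambda>n::nat. to_plane 0) (to_plane (of_plane \<xi>)) sequentially"
      using that(2,3) \<xi>(1) by (simp add: one_Isom_eq base_point_eq disc_map_to_plane)
    then have "(\<lambda>n::nat. 0) \<longlonglongrightarrow> of_plane \<xi>" by (simp only: limitin_to_plane)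
    then show False using \<xi>(2) by (simp add: LIMSEQ_const_iff)
  qed
  then show ?thesis unfolding limit_set_def by blast
qed

theorem theorem3:
  shows "(\<exists>G G1 G2. Fuchsian G \<and>
            subgroup G1 (Isom 2) \<and> G1 \<subseteq> G \<and> subgroup G2 (Isom 2) \<and> G2 \<subseteq> G \<and>
            radial_limit_set 2 G1 \<inter> radial_limit_set 2 G2 \<noteq> {} \<and>
            G1 \<inter> G2 = {\<one>\<^bsub>Isom 2\<^esub>}) \<and>
         \<not> (\<forall>d::nat. d \<ge> 2 \<longrightarrow>
              (\<forall>G. subgroup G (Isom d) \<and> discrete_isom d G \<and> non_elementary d G \<longrightarrow>
                (\<forall>G1 G2. subgroup G1 (Isom d) \<and> G1 \<subseteq> G \<and> non_elementary d G1 \<and>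
                         subgroup G2 (Isom d) \<and> G2 \<subseteq> G \<and> non_elementary d G2 \<longrightarrow>
                   radial_limit_set d G1 \<inter> radial_limit_set d G2 \<subseteq> limit_set d (G1 \<inter> G2))))"
proof -
  let ?G = "word_group id" and ?G1 = "word_group even_pairing" and ?G2 = "word_group odd_pairing"
  obtain \<eta> where \<eta>: "cmod \<eta> = 1" "(\<lambda>n. word_action [0..<n] 0) \<longlonglongrightarrow> \<eta>"
    "\<And>n. 0 < n \<Longrightarrow> cmod (\<eta> - word_action [0..<n] 0) \<le> 5/2 * (1 - cmod (word_action [0..<n] 0))"
    by (rule prefixes_converge_radially) blast
  have "to_plane \<eta> \<in> radial_limit_set 2 ?G1"
  proof (rule radial_limit_word_group[where \<rho> = "\<lambda>n. 2 * Suc n", OF \<eta>])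
    show "[0..<2 * Suc n] \<in> block_words even_pairing" for n by (rule even_prefix_in_block_words)
  qed (simp_all add: strict_mono_def)
  moreover have "to_plane \<eta> \<in> radial_limit_set 2 ?G2"
  proof (rule radial_limit_word_group[where \<rho> = "\<lambda>n. 2 * n + 1", OF \<eta>])
    show "[0..<2 * n + 1] \<in> block_words odd_pairing" for n by (rule odd_prefix_in_block_words)
  qed (simp_all add: strict_mono_def)
  ultimately have radial: "to_plane \<eta> \<in> radial_limit_set 2 ?G1 \<inter> radial_limit_set 2 ?G2" by blast
  have sub: "subgroup ?G (Isom 2)" "subgroup ?G1 (Isom 2)" "subgroup ?G2 (Isom 2)"
    by (simp_all add: subgroup_word_group even_pairing_invol odd_pairing_invol)
  have ne: "non_elementary 2 ?G" "non_elementary 2 ?G1" "non_elementary 2 ?G2"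
    by (simp_all add: non_elementary_word_group even_pairing_invol odd_pairing_invol)
  have le: "?G1 \<subseteq> ?G" "?G2 \<subseteq> ?G" by (rule word_group_id_superset)+
  show ?thesis
  proof (intro conjI notI, goal_cases)
    case 1
    have "Fuchsian ?G" using sub(1) discrete_word_group by (simp add: Fuchsian_def)
    moreover have "radial_limit_set 2 ?G1 \<inter> radial_limit_set 2 ?G2 \<noteq> {}" using radial by blast
    ultimately show ?case
      using sub(2,3) le word_group_inter
      by (intro exI[of _ ?G] exI[of _ ?G1] exI[of _ ?G2]) simp
  next
    case 2
    have "radial_limit_set 2 ?G1 \<inter> radial_limit_set 2 ?G2 \<subseteq> limit_set 2 (?G1 \<inter> ?G2)"
      by (rule 2[rule_format, of 2 ?G]) (simp_all add: sub ne le discrete_word_group)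
    then show False using radial by (simp add: word_group_inter limit_set_trivial)
  qed
qed

end
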